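(* Let $m$ be even and $k\geq 1$ an integer. Let $G$ be the graph obtained from $K_m$ by deleting the edges of a perfect matching ($\frac{m}{2}K_2$), and let $H$ be a connected subgraph of $K_{(k-1)(m-1)+1}$ with $\chi_G(H)=k$. Then $H$ is $k$-$G$-free-minimal if and only if either $k$ is even and $H$ is the graph $K_{(k-1)(m-1)+1}$ minus the edges of a $1$-factor, or $k$ is odd and $H\cong H_1\oplus K_1$, where $H_1$ is the graph $K_{(k-1)(m-1)}$ minus the edges of a $1$-factor.
   Context: All graphs are finite, simple and undirected. The join $A\oplus B$ of graphs $A,B$ is obtained from their disjoint union by joining every vertex of $A$ to every vertex of $B$. A $1$-factor is a perfect matching. For a graph $G$ on at least 2 vertices, a $G$-free $k$-colouring of a graph $H$ is a map $\pi:V(H)\to\{1,\dots,k\}$ such that for every $i$ the subgraph of $H$ induced by $\pi^{-1}(i)$ contains no subgraph isomorphic to $G$. The $G$-free chromatic number $\chi_G(H)$ is the least $k$ for which a $G$-free $k$-colouring of $H$ exists. $H$ is $G$-free-minimal if $\chi_G(H\setminus\{e\})=\chi_G(H)-1$ for every edge $e\in E(H)$; $H$ is $k$-$G$-free-minimal if moreover $\chi_G(H)=k$.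
   Formalization: The case m = 2 with k ≥ 3 is excluded: there G = 2K_1, χ_G(H) = |V(H)|, and deleting an edge never lowers χ_G, so e.g. H = C_4 (k = 4) or P_3 (k = 3) has the stated form but is not minimal. The cases m = 2, k ≤ 2 are kept. *)

theory Defs
  imports "Graph_Theory.Graph_Theory" "HOL-Library.FuncSet"
begin

text \<open>
  Graphs are symmetric loop-free digraphs without parallel arcs
  (locale \<^locale>\<open>pair_graph\<close>): an undirected edge is a pair of opposite arcs,
  and a set of undirected edges is a symmetric set of arcs.
\<close>

definition contains_copy :: "('a, 'b) pre_digraph \<Rightarrow> ('c, 'd) pre_digraph \<Rightarrow> bool" where
  "contains_copy G H \<longleftrightarrow> (\<exists>S. subgraph S H \<and> digraph_iso G S)"

definition free_colouring ::
    "'b pair_pre_digraph \<Rightarrow> nat \<Rightarrow> 'a pair_pre_digraph \<Rightarrow> ('a \<Rightarrow> nat) \<Rightarrow> bool" where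
  "free_colouring G k H \<pi> \<longleftrightarrow>
     \<pi> \<in> pverts H \<rightarrow> {1..k} \<and>
     (\<forall>i\<in>{1..k}. \<not> contains_copy (with_proj G) (with_proj H \<restriction> {v \<in> pverts H. \<pi> v = i}))"

text \<open>
  If \<open>G\<close> has at least two vertices, an injective colouring of a finite graph is \<open>G\<close>-free,
  so the minimum below is attained; for smaller \<open>G\<close> it may be unspecified.
\<close>

definition free_chromatic_number :: "'b pair_pre_digraph \<Rightarrow> 'a pair_pre_digraph \<Rightarrow> nat" where
  "free_chromatic_number G H = (LEAST k. \<exists>\<pi>. free_colouring G k H \<pi>)"

definition delete_edges :: "'a pair_pre_digraph \<Rightarrow> 'a rel \<Rightarrow> 'a pair_pre_digraph" where
  "delete_edges H F = \<lparr>pverts = pverts H, parcs = parcs H - F\<rparr>"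

text \<open>
  The subtraction of natural numbers is harmless: a graph with an edge has positive
  \<open>G\<close>-free chromatic number.
\<close>

definition free_minimal :: "'b pair_pre_digraph \<Rightarrow> 'a pair_pre_digraph \<Rightarrow> bool" where
  "free_minimal G H \<longleftrightarrow>
     (\<forall>(u, v)\<in>parcs H.
        free_chromatic_number G (delete_edges H {(u, v), (v, u)}) = free_chromatic_number G H - 1)"

definition k_free_minimal :: "nat \<Rightarrow> 'b pair_pre_digraph \<Rightarrow> 'a pair_pre_digraph \<Rightarrow> bool" where
  "k_free_minimal k G H \<longleftrightarrow> free_minimal G H \<and> free_chromatic_number G H = k"

definition one_factor :: "'a rel \<Rightarrow> 'a pair_pre_digraph \<Rightarrow> bool" where
  "one_factor M H \<longleftrightarrow> M \<subseteq> parcs H \<and> sym M \<and> (\<forall>v\<in>pverts H. \<exists>!w. (v, w) \<in> M)"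

text \<open>
  The complete graph may have any vertex set of the right size, so this predicate
  is invariant under isomorphism.
\<close>

definition complete_minus_one_factor :: "nat \<Rightarrow> 'a pair_pre_digraph \<Rightarrow> bool" where
  "complete_minus_one_factor n H \<longleftrightarrow>
     (\<exists>K M. complete_digraph n (with_proj K) \<and> one_factor M K \<and> H = delete_edges K M)"

definition graph_join ::
    "'a pair_pre_digraph \<Rightarrow> 'b pair_pre_digraph \<Rightarrow> ('a + 'b) pair_pre_digraph" where
  "graph_join A B =
     \<lparr>pverts = pverts A <+> pverts B,
      parcs = map_prod Inl Inl ` parcs A \<union> map_prod Inr Inr ` parcs B
        \<union> Inl ` pverts A \<times> Inr ` pverts B \<union> Inr ` pverts B \<times> Inl ` pverts A\<rparr>"

end

theory Submission
  imports Defs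
begin

text \<open>
  Put \<open>n = (k - 1) (m - 1)\<close>. Sets of fewer than \<open>m\<close> vertices are \<open>G\<close>-free, and a set of exactly \<open>m\<close>
  vertices is \<open>G\<close>-free iff some vertex of it has two non-neighbours in it: a matching in the
  complement extends to a perfect matching because \<open>m\<close> is even. Splitting the vertices into classes
  of size \<open>m - 1\<close>, plus possibly one \<open>G\<close>-free class of size \<open>m\<close>, a graph on at most \<open>n + 1\<close> vertices
  fails to be \<open>(k - 1)\<close>-colourable iff it has exactly \<open>n + 1\<close> vertices and its complement is a
  matching. So deleting an edge lowers the chromatic number iff the edge meets the complementary
  matching, and \<open>H\<close> is minimal iff this matching misses at most one vertex. As \<open>n + 1\<close> and \<open>k\<close> have
  the same parity, it misses none when \<open>k\<close> is even and exactly one when \<open>k\<close> is odd.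
\<close>

subsection \<open>Copies as embeddings\<close>

text \<open>Library isomorphisms carry separate maps on vertices and on arcs. Here tails and heads
  are \<open>fst\<close> and \<open>snd\<close>, so on arcs the second map must be
  \<open>map_prod f f\<close>; well-formedness of \<open>A\<close> makes that map injective on
  arcs.\<close>

lemma digraph_iso_with_proj_iff:
  assumes "pair_wf_digraph A"
  shows "digraph_iso (with_proj A) (with_proj B) \<longleftrightarrow>
    (\<exists>f. bij_betw f (pverts A) (pverts B) \<and> parcs B = map_prod f f ` parcs A)"
proof
  assume "digraph_iso (with_proj A) (with_proj B)"
  then obtain f where f: "pre_digraph.digraph_isomorphism (with_proj A) f"
    and B: "with_proj B = app_iso f (with_proj A)"
    unfolding digraph_iso_def by blast
  have verts: "pverts B = iso_verts f ` pverts A" and arcs: "parcs B = iso_arcs f ` parcs A"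
    and ends: "iso_tail f = fst" "iso_head f = snd"
    using arg_cong[OF B, of verts] arg_cong[OF B, of arcs]
      arg_cong[OF B, of tail] arg_cong[OF B, of head] by simp_all
  have "iso_arcs f e = map_prod (iso_verts f) (iso_verts f) e" if "e \<in> parcs A" for e
    using f that ends by (auto simp: pre_digraph.digraph_isomorphism_def prod_eq_iff)
  then have "parcs B = map_prod (iso_verts f) (iso_verts f) ` parcs A"
    unfolding arcs by (rule image_cong[OF refl])
  moreover have "bij_betw (iso_verts f) (pverts A) (pverts B)"
    using f verts by (auto simp: pre_digraph.digraph_isomorphism_def bij_betw_def)
  ultimately show "\<exists>f. bij_betw f (pverts A) (pverts B) \<and> parcs B = map_prod f f ` parcs A"
    by blast
next
  assume "\<exists>f. bij_betw f (pverts A) (pverts B) \<and> parcs B = map_prod f f ` parcs A"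
  then obtain f where f: "bij_betw f (pverts A) (pverts B)" "parcs B = map_prod f f ` parcs A"
    by blast
  interpret A: pair_wf_digraph A by fact
  let ?h = "\<lparr>iso_verts = f, iso_arcs = map_prod f f, iso_head = snd, iso_tail = fst\<rparr>"
  have inj: "inj_on f (pverts A)"
    using f by (simp add: bij_betw_def)
  have "parcs A \<subseteq> pverts A \<times> pverts A"
    by (auto dest: A.in_arcsD1 A.in_arcsD2)
  then have "inj_on (map_prod f f) (parcs A)"
    using map_prod_inj_on[OF inj inj] inj_on_subset by blast
  then have "pre_digraph.digraph_isomorphism (with_proj A) ?h"
    using inj A.wf_digraph by (auto simp: pre_digraph.digraph_isomorphism_def)
  moreover have "with_proj B = app_iso ?h (with_proj A)"
    using f by (auto simp: app_iso_def with_proj_def bij_betw_def)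
  ultimately show "digraph_iso (with_proj A) (with_proj B)"
    unfolding digraph_iso_def by blast
qed

text \<open>An injective homomorphism rather than an induced embedding: extra edges between images
  are allowed, just as copies are arbitrary subgraphs.\<close>

definition embedding ::
    "'b pair_pre_digraph \<Rightarrow> 'a pair_pre_digraph \<Rightarrow> 'a set \<Rightarrow> ('b \<Rightarrow> 'a) \<Rightarrow> bool" where
  "embedding G H S f \<longleftrightarrow>
    inj_on f (pverts G) \<and> f ` pverts G \<subseteq> S \<and> (\<forall>(u, v)\<in>parcs G. (f u, f v) \<in> parcs H)"

text \<open>Copies of \<open>G\<close> inside \<open>S\<close> are exactly the images of embeddings
  into \<open>S\<close>, so all later arguments can work with a plain function.\<close>

lemma contains_copy_restrict_iff:
  assumes "pair_wf_digraph G" and "pair_wf_digraph H" and "S \<subseteq> pverts H"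
  shows "contains_copy (with_proj G) (with_proj H \<restriction> S) \<longleftrightarrow> (\<exists>f. embedding G H S f)"
proof
  assume "contains_copy (with_proj G) (with_proj H \<restriction> S)"
  then obtain T where sub: "subgraph T (with_proj H \<restriction> S)" and iso: "digraph_iso (with_proj G) T"
    unfolding contains_copy_def by blast
  \<comment> \<open>A subgraph inherits the tail and head functions of the host, so it is again
    given by pairs.\<close>
  obtain T' where T: "T = with_proj T'"
  proof
    show "T = with_proj \<lparr>pverts = verts T, parcs = arcs T\<rparr>"
      using sub by (auto elim!: subgraphE simp: compatible_def with_proj_def induce_subgraph_def)
  qed
  obtain f where f: "bij_betw f (pverts G) (pverts T')" "parcs T' = map_prod f f ` parcs G"
    using iso unfolding T digraph_iso_with_proj_iff[OF assms(1)] by auto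
  have "pverts T' \<subseteq> S" "parcs T' \<subseteq> parcs H"
    using sub T by (auto elim!: subgraphE simp: induce_subgraph_def)
  then have "embedding G H S f"
    using f unfolding embedding_def bij_betw_def by force
  then show "\<exists>f. embedding G H S f" by blast
next
  interpret G: pair_wf_digraph G by fact
  interpret H: pair_wf_digraph H by fact
  assume "\<exists>f. embedding G H S f"
  then obtain f where f: "embedding G H S f" ..
  let ?T = "\<lparr>pverts = f ` pverts G, parcs = map_prod f f ` parcs G\<rparr>"
  have "digraph_iso (with_proj G) (with_proj ?T)"
    using f digraph_iso_with_proj_iff[OF assms(1), of ?T]
    by (auto simp: embedding_def bij_betw_def)
  moreover have "pair_wf_digraph ?T"
    by unfold_locales (auto dest: G.in_arcsD1 G.in_arcsD2)
  then have "wf_digraph (with_proj ?T)"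
    by (simp add: wf_digraph_wp_iff)
  moreover have "wf_digraph (with_proj H \<restriction> S)"
    by unfold_locales (auto simp: induce_subgraph_def)
  ultimately have "digraph_iso (with_proj G) (with_proj ?T)"
     "subgraph (with_proj ?T) (with_proj H \<restriction> S)"
    using f G.in_arcsD1 G.in_arcsD2
    by (auto simp: subgraph_def compatible_def embedding_def induce_subgraph_def image_subset_iff)
  then show "contains_copy (with_proj G) (with_proj H \<restriction> S)"
    unfolding contains_copy_def by blast
qed

lemma free_colouring_iff:
  assumes "pair_wf_digraph G" and "pair_wf_digraph H"
  shows "free_colouring G k H \<pi> \<longleftrightarrow> \<pi> \<in> pverts H \<rightarrow> {1..k} \<and>
    (\<forall>i\<in>{1..k}. \<nexists>f. embedding G H {v \<in> pverts H. \<pi> v = i} f)"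
  unfolding free_colouring_def using assms by (simp add: contains_copy_restrict_iff)

subsection \<open>Complete graphs minus a one-factor\<close>

text \<open>A perfect matching is handled as a fixed-point-free involution \<open>g\<close>.\<close>

lemma complete_minus_one_factorE:
  assumes "complete_minus_one_factor n H"
  obtains g where "finite (pverts H)" "card (pverts H) = n"
    "\<forall>v\<in>pverts H. g v \<in> pverts H \<and> g v \<noteq> v \<and> g (g v) = v"
    "parcs H = {(u, v). u \<in> pverts H \<and> v \<in> pverts H \<and> u \<noteq> v \<and> v \<noteq> g u}"
proof -
  obtain K M where K: "complete_digraph n (with_proj K)" and M: "one_factor M K"
    and H: "H = delete_edges K M"
    using assms unfolding complete_minus_one_factor_def by blast
  define g where "g v = (THE w. (v, w) \<in> M)" for v
  have V: "pverts H = pverts K"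
    by (simp add: H delete_edges_def)
  have KV: "finite (pverts K)" "card (pverts K) = n"
    "parcs K = {(u, v). (u, v) \<in> pverts K \<times> pverts K \<and> u \<noteq> v}"
    using K by (auto simp: complete_digraph_pair_def)
  have g: "(v, w) \<in> M \<longleftrightarrow> w = g v" if "v \<in> pverts K" for v w
    using M that theI'[of "\<lambda>w. (v, w) \<in> M"] unfolding one_factor_def g_def by blast
  have gV: "g v \<in> pverts K \<and> g v \<noteq> v" if "v \<in> pverts K" for v
    using g[OF that, of "g v"] M KV by (auto simp: one_factor_def)
  have gg: "g (g v) = v" if "v \<in> pverts K" for v
    using g[of "g v" v] g[of v "g v"] gV[OF that] that M
    by (auto simp: one_factor_def dest: symD)
  show thesis
  proof
    show "finite (pverts H)" "card (pverts H) = n"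
      using KV V by auto
    show "\<forall>v\<in>pverts H. g v \<in> pverts H \<and> g v \<noteq> v \<and> g (g v) = v"
      using gV gg V by auto
    show "parcs H = {(u, v). u \<in> pverts H \<and> v \<in> pverts H \<and> u \<noteq> v \<and> v \<noteq> g u}"
      using KV g unfolding H delete_edges_def by auto
  qed
qed

lemma complete_minus_one_factorI:
  assumes "finite (pverts H)" "card (pverts H) = n"
    and g: "\<And>v. v \<in> pverts H \<Longrightarrow> g v \<in> pverts H \<and> g v \<noteq> v \<and> g (g v) = v"
    and E: "parcs H = {(u, v). u \<in> pverts H \<and> v \<in> pverts H \<and> u \<noteq> v \<and> v \<noteq> g u}"
  shows "complete_minus_one_factor n H"
proof -
  let ?K = "\<lparr>pverts = pverts H, parcs = {(u, v). (u, v) \<in> pverts H \<times> pverts H \<and> u \<noteq> v}\<rparr>"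
  let ?M = "{(u, v). u \<in> pverts H \<and> v = g u}"
  have "complete_digraph n (with_proj ?K)"
    using assms(1,2) by (simp add: complete_digraph_pair_def)
  moreover have "one_factor ?M ?K"
    using g unfolding one_factor_def by (force intro: symI)
  moreover have "H = delete_edges ?K ?M"
    unfolding delete_edges_def using E by (intro pair_pre_digraph.equality) auto
  ultimately show ?thesis
    unfolding complete_minus_one_factor_def by blast
qed

lemma card_eq_Suc_Suc_Diff:
  assumes "finite A" "a \<in> A" "b \<in> A" "a \<noteq> b"
  shows "card A = Suc (Suc (card (A - {a, b})))"
proof -
  have "A = insert a (insert b (A - {a, b}))" using assms by auto
  then show ?thesis
    using assms(1,4) card_insert_disjoint[of "insert b (A - {a, b})" a]
      card_insert_disjoint[of "A - {a, b}" b] by simp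
qed

text \<open>The orbits \<open>{v, g v}\<close> all have two elements; the induction removes one
  orbit at a time.\<close>

lemma even_card_involution:
  assumes "finite V" and "\<And>v. v \<in> V \<Longrightarrow> g v \<in> V \<and> g v \<noteq> v \<and> g (g v) = v"
  shows "even (card V)"
  using assms
proof (induction "card V" arbitrary: V rule: less_induct)
  case less
  show ?case
  proof (cases "V = {}")
    case False
    then obtain v where v: "v \<in> V" by blast
    let ?W = "V - {v, g v}"
    have "card V = Suc (Suc (card ?W))"
      using v less.prems(2)[OF v] less.prems(1) by (intro card_eq_Suc_Suc_Diff) auto
    moreover have "even (card ?W)"
    proof (rule less.hyps)
      show "card ?W < card V" using calculation by simp
      show "g x \<in> ?W \<and> g x \<noteq> x \<and> g (g x) = x" if "x \<in> ?W" for x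
        using that less.prems(2)[of x] less.prems(2)[of v] v by auto
    qed (use less.prems(1) in simp)
    ultimately show ?thesis by simp
  qed simp
qed

section \<open>Graphs whose complement is a matching\<close>

text \<open>The complement of \<open>H\<close> has maximum degree at most one: it is a matching,
  possibly not perfect and possibly empty.\<close>

definition co_matching :: "'a pair_pre_digraph \<Rightarrow> bool" where
  "co_matching H \<longleftrightarrow> (\<forall>v\<in>pverts H. \<forall>u\<in>pverts H. \<forall>w\<in>pverts H.
     u \<noteq> v \<longrightarrow> w \<noteq> v \<longrightarrow> (v, u) \<notin> parcs H \<longrightarrow> (v, w) \<notin> parcs H \<longrightarrow> u = w)"

lemma co_matchingD:
  assumes "co_matching H" "v \<in> pverts H" "u \<in> pverts H" "w \<in> pverts H"
    "u \<noteq> v" "w \<noteq> v" "(v, u) \<notin> parcs H" "(v, w) \<notin> parcs H"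
  shows "u = w"
  using assms unfolding co_matching_def by blast

text \<open>
  The pairs \<open>{v, g v}\<close> are placed one at a time: on a non-edge of \<open>H\<close> inside \<open>S\<close> while there is
  one, and anywhere afterwards. No other non-edge of \<open>H\<close> meets the chosen pair.
\<close>

lemma co_matching_placement:
  assumes "co_matching H" "sym (parcs H)" "S \<subseteq> pverts H"
    and "finite V" "finite S" "card S = card V"
    and "\<And>v. v \<in> V \<Longrightarrow> g v \<in> V \<and> g v \<noteq> v \<and> g (g v) = v"
  shows "\<exists>f. inj_on f V \<and> f ` V \<subseteq> S \<and>
    (\<forall>u\<in>V. \<forall>v\<in>V. u \<noteq> v \<longrightarrow> v \<noteq> g u \<longrightarrow> (f u, f v) \<in> parcs H)"
  using assms(3-)
proof (induction "card V" arbitrary: V S rule: less_induct)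
  case less
  show ?case
  proof (cases "V = {}")
    case False
    then obtain v where v: "v \<in> V" by blast
    let ?W = "V - {v, g v}"
    have gv: "g v \<in> V" "g v \<noteq> v" "g (g v) = v"
      using less.prems(5)[OF v] by auto
    have cW: "card V = Suc (Suc (card ?W))"
      using v gv less.prems(2) by (intro card_eq_Suc_Suc_Diff) auto
    obtain a b where ab: "a \<in> S" "b \<in> S" "a \<noteq> b"
      and far: "\<And>c. c \<in> S \<Longrightarrow> c \<noteq> a \<Longrightarrow> c \<noteq> b \<Longrightarrow> (a, c) \<in> parcs H \<and> (b, c) \<in> parcs H"
    proof (cases "\<exists>a\<in>S. \<exists>b\<in>S. a \<noteq> b \<and> (a, b) \<notin> parcs H")
      case True
      then obtain a b where *: "a \<in> S" "b \<in> S" "a \<noteq> b" "(a, b) \<notin> parcs H" by blast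
      moreover have "(b, a) \<notin> parcs H"
        using * assms(2) by (auto dest: symD)
      moreover have "(a, c) \<in> parcs H \<and> (b, c) \<in> parcs H" if "c \<in> S" "c \<noteq> a" "c \<noteq> b" for c
        using * that less.prems(1) \<open>(b, a) \<notin> parcs H\<close>
          co_matchingD[OF assms(1), of a b c] co_matchingD[OF assms(1), of b a c] by auto
      ultimately show thesis
        using that[of a b] by simp
    next
      \<comment> \<open>All distinct vertices of \<open>S\<close> are adjacent, so any two of them
        qualify.\<close>
      case False
      have "2 \<le> card S" using cW less.prems(4) by simp
      then obtain a b where "a \<in> S" "b \<in> S" "a \<noteq> b"
        using card_le_Suc0_iff_eq[OF less.prems(3)] by fastforce
      then show thesis using False by (intro that[of a b]) auto
    qed
    let ?S = "S - {a, b}"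
    have cS: "card S = Suc (Suc (card ?S))"
      using ab less.prems(3) by (intro card_eq_Suc_Suc_Diff) auto
    have "\<exists>f. inj_on f ?W \<and> f ` ?W \<subseteq> ?S \<and>
      (\<forall>u\<in>?W. \<forall>v\<in>?W. u \<noteq> v \<longrightarrow> v \<noteq> g u \<longrightarrow> (f u, f v) \<in> parcs H)"
    proof (rule less.hyps)
      show "card ?W < card V" using cW by simp
      show "card ?S = card ?W" using cW cS less.prems(4) by simp
      show "g x \<in> ?W \<and> g x \<noteq> x \<and> g (g x) = x" if "x \<in> ?W" for x
        using that less.prems(5)[of x] gv v by auto
    qed (use less.prems(1-3) in auto)
    then obtain f where f: "inj_on f ?W" "f ` ?W \<subseteq> ?S"
      and fE: "\<forall>u\<in>?W. \<forall>w\<in>?W. u \<noteq> w \<longrightarrow> w \<noteq> g u \<longrightarrow> (f u, f w) \<in> parcs H"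
      by (elim exE conjE)
    \<comment> \<open>No arc is required between the images \<open>a\<close> and \<open>b\<close> of
      \<open>v\<close> and \<open>g v\<close>; \<open>far\<close> supplies all other arcs at these
      two vertices.\<close>
    define h where "h = f(v := a, g v := b)"
    have h: "h v = a" "h (g v) = b" "\<And>x. x \<in> ?W \<Longrightarrow> h x = f x"
      using gv by (auto simp: h_def)
    have V: "V = insert v (insert (g v) ?W)" using v gv by auto
    have fS: "f x \<in> S" "f x \<noteq> a" "f x \<noteq> b" if "x \<in> ?W" for x
      using f(2) that by auto
    have "inj_on h ?W"
      using f(1) inj_on_cong[of ?W h f] h(3) by metis
    moreover have "h ` ?W \<subseteq> ?S" using f(2) h(3) by auto
    ultimately have "inj_on h V"
      using ab h(1,2) gv(2) by (subst V) (auto simp: inj_on_insert)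
    moreover have "h ` V \<subseteq> S"
      using ab h fS by (subst V) auto
    moreover have "(h x, h y) \<in> parcs H" if xy: "x \<in> V" "y \<in> V" "x \<noteq> y" "y \<noteq> g x" for x y
    proof (cases "x \<in> ?W")
      case x: True
      show ?thesis
      proof (cases "y \<in> ?W")
        case True
        then show ?thesis using x xy fE h by auto
      next
        case False
        then have "h y = a \<or> h y = b" using xy h by auto
        then show ?thesis
          using far fS[OF x] h(3)[OF x] assms(2) by (auto dest: symD)
      qed
    next
      case False
      then have "x = v \<or> x = g v" using xy by auto
      \<comment> \<open>As \<open>g\<close> swaps \<open>v\<close> and \<open>g v\<close>, excluding
        \<open>x\<close> and \<open>g x\<close> excludes both of them, so \<open>y\<close> lies in
        \<open>?W\<close>.\<close>
      then have "y \<in> ?W" "h x = a \<or> h x = b" using xy gv h by auto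
      then show ?thesis using far fS h(3) by auto
    qed
    ultimately show ?thesis by blast
  qed auto
qed

lemma embedding_card_le:
  assumes "embedding G H S f" and "finite S"
  shows "card (pverts G) \<le> card S"
  using assms card_inj_on_le unfolding embedding_def by blast

text \<open>Any \<open>m\<close> vertices of \<open>S\<close> already carry a copy: the placement
  above puts the matched pairs of \<open>G\<close> on them, covering the non-edges.\<close>

lemma embedding_exists:
  assumes "complete_minus_one_factor m G" and "co_matching H" "sym (parcs H)"
    and "S \<subseteq> pverts H" "finite S" "m \<le> card S"
  shows "\<exists>f. embedding G H S f"
proof -
  obtain T where T: "T \<subseteq> S" "card T = m" "finite T"
    using assms(6) by (rule obtain_subset_with_card_n)
  obtain g where g: "finite (pverts G)" "card (pverts G) = m"
    "\<forall>v\<in>pverts G. g v \<in> pverts G \<and> g v \<noteq> v \<and> g (g v) = v"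
    "parcs G = {(u, v). u \<in> pverts G \<and> v \<in> pverts G \<and> u \<noteq> v \<and> v \<noteq> g u}"
    using assms(1) by (rule complete_minus_one_factorE)
  have "T \<subseteq> pverts H" "card T = card (pverts G)"
    using T assms(4) g(2) by auto
  then have "\<exists>f. inj_on f (pverts G) \<and> f ` pverts G \<subseteq> T \<and>
    (\<forall>u\<in>pverts G. \<forall>v\<in>pverts G. u \<noteq> v \<longrightarrow> v \<noteq> g u \<longrightarrow> (f u, f v) \<in> parcs H)"
    using co_matching_placement[OF assms(2,3) _ g(1) T(3)] bspec[OF g(3)] by simp
  then obtain f where "inj_on f (pverts G)" "f ` pverts G \<subseteq> T"
    "\<forall>u\<in>pverts G. \<forall>v\<in>pverts G. u \<noteq> v \<longrightarrow> v \<noteq> g u \<longrightarrow> (f u, f v) \<in> parcs H"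
    by (elim exE conjE)
  then have "embedding G H S f"
    using T(1) g(4) by (auto simp: embedding_def)
  then show ?thesis by blast
qed

text \<open>On exactly \<open>m\<close> vertices an embedding is onto, so \<open>u\<close> and
  \<open>w\<close> pull back to two distinct non-neighbours of the preimage of \<open>v\<close>,
  while each vertex of \<open>G\<close> has only one.\<close>

lemma no_embedding:
  assumes "complete_minus_one_factor m G" and "finite S" "card S = m"
    and vuw: "v \<in> S" "u \<in> S" "w \<in> S" "u \<noteq> v" "w \<noteq> v" "u \<noteq> w"
    and non: "(v, u) \<notin> parcs H" "(v, w) \<notin> parcs H"
  shows "\<not> embedding G H S f"
proof
  assume f: "embedding G H S f"
  obtain g where g: "finite (pverts G)" "card (pverts G) = m"
    "parcs G = {(u, v). u \<in> pverts G \<and> v \<in> pverts G \<and> u \<noteq> v \<and> v \<noteq> g u}"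
    using assms(1) by (rule complete_minus_one_factorE)
  have "f ` pverts G = S"
    using f g(2) assms(2,3) by (intro card_subset_eq) (auto simp: embedding_def card_image)
  then obtain v' u' w' where *: "v' \<in> pverts G" "u' \<in> pverts G" "w' \<in> pverts G"
    "f v' = v" "f u' = u" "f w' = w"
    using vuw by blast
  then have "(v', u') \<notin> parcs G" "(v', w') \<notin> parcs G"
    using f non by (auto simp: embedding_def)
  then have "u' = g v'" "w' = g v'"
    using * vuw unfolding g(3) by auto
  then show False
    using * vuw by simp
qed

subsection \<open>Colourability\<close>

text \<open>Number the elements of \<open>W\<close> from 0 and cut the numbering into consecutive
  blocks of length \<open>d\<close>; each block is a class.\<close>

lemma balanced_partition:
  fixes W :: "'a set" and c d :: nat
  assumes "finite W" and "card W \<le> c * d"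
  shows "\<exists>\<pi>. \<pi> \<in> W \<rightarrow> {1..c} \<and> (\<forall>i. card {v \<in> W. \<pi> v = i} \<le> d)"
proof (cases "d = 0")
  case True
  then have "W = {}" using assms by simp
  then show ?thesis by simp
next
  case False
  obtain h where h: "bij_betw h W {0..<card W}"
    using ex_bij_betw_finite_nat[OF assms(1)] by blast
  define \<pi> where "\<pi> v = Suc (h v div d)" for v
  have "h v < c * d" if "v \<in> W" for v
    using h that assms(2) by (fastforce dest: bij_betwE)
  then have "\<pi> \<in> W \<rightarrow> {1..c}"
    by (auto simp: \<pi>_def less_mult_imp_div_less Suc_le_eq)
  moreover have "card {v \<in> W. \<pi> v = i} \<le> d" for i
  proof -
    \<comment> \<open>Colours start at 1, so colour \<open>i\<close> owns the block beginning at
      \<open>(i - 1) * d\<close>. Class 0 is empty, and the truncated subtraction does no harm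
      there.\<close>
    have "h ` {v \<in> W. \<pi> v = i} \<subseteq> {(i - 1) * d..<(i - 1) * d + d}"
    proof safe
      fix v
      have "(h v div d) * d \<le> h v" "h v < (h v div d) * d + d"
        using False by (simp_all add: dividend_less_div_times add.commute)
      then show "h v \<in> {(\<pi> v - 1) * d..<(\<pi> v - 1) * d + d}"
        by (simp add: \<pi>_def)
    qed
    moreover have "inj_on h {v \<in> W. \<pi> v = i}"
      using h by (auto simp: bij_betw_def intro: inj_on_subset)
    ultimately have "card {v \<in> W. \<pi> v = i} \<le> card {(i - 1) * d..<(i - 1) * d + d}"
      using card_inj_on_le finite_atLeastLessThan by blast
    then show ?thesis by simp
  qed
  ultimately show ?thesis by blast
qed

lemma pair_graph_delete_edge:
  assumes "pair_graph H"
  shows "pair_graph (delete_edges H {(u, v), (v, u)})"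
proof -
  interpret H: pair_graph H by fact
  show ?thesis
    using H.arcs_symmetric H.no_loops'
    by unfold_locales
      (auto simp: delete_edges_def symmetric_def H.in_arcsD1 H.in_arcsD2 intro!: symI)
qed

section \<open>Colour classes free of a fixed cocktail party graph\<close>

text \<open>The cocktail party graph is complete multipartite with all parts of size two. The bound
  \<open>2 \<le> m\<close> rules out the empty graph, which would embed into every set.\<close>

locale cocktail_party_graph =
  fixes m :: nat and G :: "'b pair_pre_digraph"
  assumes cocktail_party: "complete_minus_one_factor m G" and m_ge_2: "2 \<le> m"
begin

lemma card_verts: "card (pverts G) = m"
  using cocktail_party by (rule complete_minus_one_factorE)

lemma pair_wf: "pair_wf_digraph G"
  using cocktail_party by (rule complete_minus_one_factorE) (unfold_locales, auto)

lemma no_small_embedding: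
  assumes "finite S" and "card S < m"
  shows "\<not> embedding G H S f"
  using embedding_card_le[of G H S f] assms card_verts by fastforce

text \<open>Classes of at most \<open>m - 1\<close> vertices have no room for a copy of
  \<open>G\<close>.\<close>

lemma colourable_of_small:
  assumes "pair_graph H" and "card (pverts H) \<le> c * (m - 1)"
  shows "\<exists>\<pi>. free_colouring G c H \<pi>"
proof -
  interpret H: pair_graph H by fact
  obtain \<pi> where \<pi>: "\<pi> \<in> pverts H \<rightarrow> {1..c}"
    and small: "card {v \<in> pverts H. \<pi> v = i} \<le> m - 1" for i
    using balanced_partition[OF H.pair_finite_verts assms(2)] by blast
  have "\<not> embedding G H {v \<in> pverts H. \<pi> v = i} f" for i f
    using small[of i] m_ge_2 H.pair_finite_verts by (intro no_small_embedding) auto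
  then show ?thesis
    using \<pi> free_colouring_iff[OF pair_wf H.pair_wf_digraph] by blast
qed

text \<open>The free set \<open>S\<close> receives the extra colour \<open>Suc c\<close> whatever
  its size; the rest is split into \<open>c\<close> classes too small for \<open>G\<close>.\<close>

lemma colourable_of_free_set:
  assumes "pair_graph H" and "S \<subseteq> pverts H" "\<nexists>f. embedding G H S f"
    and "card (pverts H - S) \<le> c * (m - 1)"
  shows "\<exists>\<pi>. free_colouring G (Suc c) H \<pi>"
proof -
  interpret H: pair_graph H by fact
  obtain \<rho> where \<rho>: "\<rho> \<in> pverts H - S \<rightarrow> {1..c}"
    and small: "card {v \<in> pverts H - S. \<rho> v = i} \<le> m - 1" for i
    using balanced_partition[OF _ assms(4)] H.pair_finite_verts by blast
  define \<pi> where "\<pi> v = (if v \<in> S then Suc c else \<rho> v)" for v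
  have "\<not> embedding G H {v \<in> pverts H. \<pi> v = i} f" if i: "i \<in> {1..Suc c}" for i f
  proof (cases "i = Suc c")
    case True
    have "\<rho> v \<noteq> Suc c" if "v \<in> pverts H - S" for v
      using Pi_mem[OF \<rho> that] by auto
    then have "{v \<in> pverts H. \<pi> v = i} = S"
      using assms(2) True by (auto simp: \<pi>_def)
    then show ?thesis using assms(3) by simp
  next
    case False
    then have "{v \<in> pverts H. \<pi> v = i} = {v \<in> pverts H - S. \<rho> v = i}"
      by (auto simp: \<pi>_def)
    then show ?thesis
      using small[of i] m_ge_2 H.pair_finite_verts by (intro no_small_embedding) auto
  qed
  moreover have "\<pi> \<in> pverts H \<rightarrow> {1..Suc c}"
    using Pi_mem[OF \<rho>] by (fastforce simp: \<pi>_def)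
  ultimately show ?thesis
    using free_colouring_iff[OF pair_wf H.pair_wf_digraph] by blast
qed

text \<open>Only one vertex is in excess of \<open>c\<close> classes of size \<open>m - 1\<close>. A
  vertex with two non-neighbours yields a free class of size \<open>m\<close>, which absorbs
  it.\<close>

lemma colourable_of_not_co_matching:
  assumes "pair_graph H" and "card (pverts H) \<le> c * (m - 1) + 1"
    and "\<not> co_matching H" and "m = 2 \<Longrightarrow> c \<le> 1"
  shows "\<exists>\<pi>. free_colouring G c H \<pi>"
proof (cases "card (pverts H) \<le> c * (m - 1)")
  case True
  with assms(1) show ?thesis by (rule colourable_of_small)
next
  case False
  interpret H: pair_graph H by fact
  have card_H: "card (pverts H) = c * (m - 1) + 1"
    using False assms(2) by simp
  obtain v u w where vuw: "v \<in> pverts H" "u \<in> pverts H" "w \<in> pverts H"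
      "u \<noteq> v" "w \<noteq> v" "u \<noteq> w" "(v, u) \<notin> parcs H" "(v, w) \<notin> parcs H"
    using assms(3) unfolding co_matching_def by blast
  have three: "3 \<le> card (pverts H)"
    using card_mono[OF H.pair_finite_verts, of "{v, u, w}"] vuw by simp
  \<comment> \<open>The three vertices must fit into a class of size \<open>m\<close>. For
    \<open>m = 2\<close> the bound \<open>c \<le> 1\<close> leaves at most two vertices in all, so
    there is no such triple.\<close>
  have m3: "3 \<le> m"
  proof (rule ccontr)
    assume "\<not> 3 \<le> m"
    then have "m = 2" using m_ge_2 by simp
    then show False using three card_H assms(4) by simp
  qed
  obtain d where d: "c = Suc d"
    using three card_H by (cases c) auto
  \<comment> \<open>Removing \<open>m\<close> vertices leaves exactly \<open>d * (m - 1)\<close>,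
    enough for \<open>d\<close> small classes.\<close>
  have cm: "card (pverts H) = d * (m - 1) + m"
    using card_H d m3 by simp
  have "m - 3 \<le> card (pverts H - {v, u, w})"
    using vuw cm by (subst card_Diff_subset) auto
  then obtain T where T: "T \<subseteq> pverts H - {v, u, w}" "card T = m - 3" "finite T"
    by (rule obtain_subset_with_card_n)
  let ?S = "insert v (insert u (insert w T))"
  have "card ?S = m"
    using T vuw m3 by (subst card_insert_disjoint | force)+
  moreover have "?S \<subseteq> pverts H" "finite ?S"
    using T vuw by auto
  moreover have "card (pverts H - ?S) \<le> d * (m - 1)"
    using calculation cm by (simp add: card_Diff_subset)
  moreover have "\<nexists>f. embedding G H ?S f"
    using no_embedding[OF cocktail_party, of ?S v u w H] vuw calculation by simp
  ultimately show ?thesis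
    using colourable_of_free_set[OF assms(1), of ?S d] d by simp
qed

text \<open>Every set of \<open>m\<close> vertices contains a copy of \<open>G\<close>, so each of
  the \<open>c\<close> classes has at most \<open>m - 1\<close> vertices and together they cannot
  cover \<open>H\<close>.\<close>

lemma not_colourable_of_co_matching:
  assumes "pair_graph H" and "co_matching H" and "c * (m - 1) < card (pverts H)"
  shows "\<not> free_colouring G c H \<pi>"
proof
  interpret H: pair_graph H by fact
  assume \<pi>: "free_colouring G c H \<pi>"
  let ?C = "\<lambda>i. {v \<in> pverts H. \<pi> v = i}"
  have *: "\<pi> \<in> pverts H \<rightarrow> {1..c}" "\<And>i f. i \<in> {1..c} \<Longrightarrow> \<not> embedding G H (?C i) f"
    using \<pi> free_colouring_iff[OF pair_wf H.pair_wf_digraph] by blast+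
  have "sym (parcs H)"
    using H.arcs_symmetric by (auto intro: symI)
  then have "card (?C i) \<le> m - 1" if "i \<in> {1..c}" for i
    using *(2)[OF that] embedding_exists[OF cocktail_party assms(2), of "?C i"] H.pair_finite_verts
    by (fastforce simp: not_less_eq_eq)
  then have "(\<Sum>i\<in>{1..c}. card (?C i)) \<le> c * (m - 1)"
    using sum_bounded_above[of "{1..c}" "\<lambda>i. card (?C i)" "m - 1"] by simp
  moreover have "pverts H = (\<Union>i\<in>{1..c}. ?C i)"
    using *(1) by auto
  then have "card (pverts H) \<le> (\<Sum>i\<in>{1..c}. card (?C i))"
    using card_UN_le[of "{1..c}" ?C] by simp
  ultimately show False using assms(3) by simp
qed

section \<open>The free chromatic number and the deletion of an edge\<close>

lemma free_chromatic_number_le: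
  "free_colouring G c H \<pi> \<Longrightarrow> free_chromatic_number G H \<le> c"
  unfolding free_chromatic_number_def by (auto intro: Least_le)

text \<open>The minimum is attained: since \<open>m - 1 \<ge> 1\<close>, as many colours as vertices
  always suffice.\<close>

lemma free_chromatic_number_colouring:
  assumes "pair_graph H"
  shows "\<exists>\<pi>. free_colouring G (free_chromatic_number G H) H \<pi>"
proof -
  have "\<exists>\<pi>. free_colouring G (card (pverts H)) H \<pi>"
    using assms m_ge_2 by (intro colourable_of_small) auto
  then show ?thesis
    unfolding free_chromatic_number_def by (rule LeastI)
qed

text \<open>Giving the end \<open>u\<close> of the deleted edge a new colour of its own repairs a
  colouring of the smaller graph, because no copy of \<open>G\<close> avoiding \<open>u\<close> can
  use that edge.\<close>

lemma free_chromatic_number_delete_edge: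
  assumes "pair_graph H"
  shows "free_chromatic_number G H \<le>
    Suc (free_chromatic_number G (delete_edges H {(u, v), (v, u)}))"
proof -
  interpret H: pair_graph H by fact
  let ?D = "delete_edges H {(u, v), (v, u)}"
  interpret D: pair_graph ?D using assms by (rule pair_graph_delete_edge)
  define c where "c = free_chromatic_number G ?D"
  obtain \<rho> where "free_colouring G c ?D \<rho>"
    using free_chromatic_number_colouring[OF D.pair_graph] unfolding c_def by blast
  then have \<rho>: "\<rho> \<in> pverts H \<rightarrow> {1..c}"
    "\<And>i f. i \<in> {1..c} \<Longrightarrow> \<not> embedding G ?D {v \<in> pverts H. \<rho> v = i} f"
    unfolding free_colouring_iff[OF pair_wf D.pair_wf_digraph] by (auto simp: delete_edges_def)
  define \<pi> where "\<pi> = \<rho>(u := Suc c)"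
  have "\<not> embedding G H {v \<in> pverts H. \<pi> v = i} f" if i: "i \<in> {1..Suc c}" for i f
  proof (cases "i = Suc c")
    case True
    have "\<rho> v \<noteq> Suc c" if "v \<in> pverts H" for v
      using Pi_mem[OF \<rho>(1) that] by auto
    \<comment> \<open>The new colour occurs at most at \<open>u\<close>, and one vertex is fewer
      than \<open>m\<close>.\<close>
    then have "{v \<in> pverts H. \<pi> v = i} \<subseteq> {u}"
      using True by (auto simp: \<pi>_def)
    then have "card {v \<in> pverts H. \<pi> v = i} \<le> 1" "finite {v \<in> pverts H. \<pi> v = i}"
      using card_mono[of "{u}"] by auto
    then show ?thesis using m_ge_2 by (intro no_small_embedding) auto
  next
    case False
    show ?thesis
    proof
      assume f: "embedding G H {v \<in> pverts H. \<pi> v = i} f"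
      have "f x \<noteq> u" if "x \<in> pverts G" for x
        using f that False by (auto simp: embedding_def \<pi>_def)
      then have "embedding G ?D {v \<in> pverts H. \<rho> v = i} f"
        using f False pair_wf
        by (auto simp: embedding_def \<pi>_def delete_edges_def image_subset_iff split: if_splits
            dest: pair_wf_digraph.in_arcsD1 pair_wf_digraph.in_arcsD2)
      then show False using \<rho>(2) i False by simp
    qed
  qed
  moreover have "\<pi> \<in> pverts H \<rightarrow> {1..Suc c}"
    using Pi_mem[OF \<rho>(1)] by (fastforce simp: \<pi>_def)
  ultimately have "free_colouring G (Suc c) H \<pi>"
    using free_colouring_iff[OF pair_wf H.pair_wf_digraph] by blast
  then show ?thesis
    unfolding c_def[symmetric] by (rule free_chromatic_number_le)
qed

end

subsection \<open>Minimality\<close>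

text \<open>For a co-matching these are the vertices left uncovered by the complementary
  matching.\<close>

definition universal_verts :: "'a pair_pre_digraph \<Rightarrow> 'a set" where
  "universal_verts H = {x \<in> pverts H. \<forall>y\<in>pverts H. y \<noteq> x \<longrightarrow> (x, y) \<in> parcs H}"

text \<open>An edge is critical iff deleting it destroys the co-matching property, that is, unless
  both its ends are universal. Universal vertices are pairwise adjacent, so two of them already give
  a non-critical edge.\<close>

lemma (in cocktail_party_graph) free_minimal_iff:
  assumes "pair_graph H" and "co_matching H"
    and card_H: "card (pverts H) = (k - 1) * (m - 1) + 1"
    and "free_chromatic_number G H = k" and "m = 2 \<Longrightarrow> k \<le> 2"
  shows "free_minimal G H \<longleftrightarrow> (\<forall>x\<in>universal_verts H. \<forall>y\<in>universal_verts H. x = y)"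
proof -
  interpret H: pair_graph H by fact
  have critical: "free_chromatic_number G (delete_edges H {(u, v), (v, u)}) = k - 1 \<longleftrightarrow>
      \<not> (u \<in> universal_verts H \<and> v \<in> universal_verts H)"
    if uv: "(u, v) \<in> parcs H" for u v
  proof -
    let ?D = "delete_edges H {(u, v), (v, u)}"
    have D: "pair_graph ?D"
      using assms(1) by (rule pair_graph_delete_edge)
    have sel: "pverts ?D = pverts H" "parcs ?D = parcs H - {(u, v), (v, u)}"
      by (simp_all add: delete_edges_def)
    have inV: "u \<in> pverts H" "v \<in> pverts H" "u \<noteq> v"
      using uv H.in_arcsD1 H.in_arcsD2 H.no_loops' by auto
    \<comment> \<open>The new non-edge keeps the complement a matching iff neither end had a
      non-neighbour before.\<close>
    have "co_matching ?D \<longleftrightarrow> u \<in> universal_verts H \<and> v \<in> universal_verts H"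
    proof
      assume D: "co_matching ?D"
      have "(u, w) \<in> parcs H" if "w \<in> pverts H" "w \<noteq> u" for w
        using co_matchingD[OF D, of u v w] inV that uv by (auto simp: sel)
      moreover have "(v, w) \<in> parcs H" if "w \<in> pverts H" "w \<noteq> v" for w
        using co_matchingD[OF D, of v u w] inV that H.arcs_symmetric[OF uv] by (auto simp: sel)
      ultimately show "u \<in> universal_verts H \<and> v \<in> universal_verts H"
        using inV by (auto simp: universal_verts_def)
    next
      assume univ: "u \<in> universal_verts H \<and> v \<in> universal_verts H"
      have "(a, w) \<in> parcs H \<and> (w, a) \<in> parcs H" if "a = u \<or> a = v" "w \<in> pverts H" "w \<noteq> a" for a w
        using univ that H.arcs_symmetric by (auto simp: universal_verts_def)
      then show "co_matching ?D"
        using assms(2) unfolding co_matching_def sel by blast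
    qed
    \<comment> \<open>\<open>?D\<close> still has one vertex more than \<open>k - 1\<close> classes
      of size \<open>m - 1\<close> can hold, so being a co-matching decides whether
      \<open>k - 1\<close> colours suffice. Fewer cannot, as one deletion lowers the number by at
      most one.\<close>
    moreover have "free_chromatic_number G ?D = k - 1 \<longleftrightarrow> \<not> co_matching ?D"
    proof
      assume *: "free_chromatic_number G ?D = k - 1"
      obtain \<pi> where "free_colouring G (k - 1) ?D \<pi>"
        using free_chromatic_number_colouring[OF D] unfolding * by blast
      then show "\<not> co_matching ?D"
        using not_colourable_of_co_matching[OF D] card_H sel by fastforce
    next
      assume *: "\<not> co_matching ?D"
      have "\<exists>\<pi>. free_colouring G (k - 1) ?D \<pi>"
        using assms(5) card_H sel by (intro colourable_of_not_co_matching[OF D _ *]) auto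
      then have "free_chromatic_number G ?D \<le> k - 1"
        using free_chromatic_number_le by blast
      moreover have "k \<le> Suc (free_chromatic_number G ?D)"
        using free_chromatic_number_delete_edge[OF assms(1)] assms(4) by simp
      ultimately show "free_chromatic_number G ?D = k - 1" by simp
    qed
    ultimately show ?thesis by blast
  qed
  have "free_minimal G H \<longleftrightarrow>
      (\<forall>(u, v)\<in>parcs H. \<not> (u \<in> universal_verts H \<and> v \<in> universal_verts H))"
    unfolding free_minimal_def assms(4) using critical by auto
  also have "\<dots> \<longleftrightarrow> (\<forall>x\<in>universal_verts H. \<forall>y\<in>universal_verts H. x = y)"
  proof -
    have "(x, y) \<in> parcs H" if "x \<in> universal_verts H" "y \<in> universal_verts H" "x \<noteq> y" for x y
      using that by (auto simp: universal_verts_def)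
    then show ?thesis using H.no_loops' by blast
  qed
  finally show ?thesis .
qed

section \<open>The structure of co-matchings\<close>

text \<open>\<open>g\<close> sends a non-universal vertex to its only non-neighbour. By symmetry the
  partner is non-universal too, with the original vertex as its own partner.\<close>

lemma co_matching_partner:
  assumes "co_matching H" and "sym (parcs H)" "\<And>v. (v, v) \<notin> parcs H"
  obtains g where "\<forall>v\<in>pverts H - universal_verts H.
      g v \<in> pverts H - universal_verts H \<and> g v \<noteq> v \<and> g (g v) = v \<and>
      (\<forall>u\<in>pverts H. (v, u) \<in> parcs H \<longleftrightarrow> u \<noteq> v \<and> u \<noteq> g v)"
proof -
  have "\<forall>v\<in>pverts H - universal_verts H. \<exists>w. w \<in> pverts H \<and> w \<noteq> v \<and> (v, w) \<notin> parcs H"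
    unfolding universal_verts_def by blast
  then obtain g where g: "\<And>v. v \<in> pverts H - universal_verts H \<Longrightarrow>
      g v \<in> pverts H \<and> g v \<noteq> v \<and> (v, g v) \<notin> parcs H"
    by metis
  have sym: "(w, v) \<notin> parcs H" if "(v, w) \<notin> parcs H" for v w
    using that assms(2) by (auto dest: symD)
  have "g v \<in> pverts H - universal_verts H \<and> g v \<noteq> v \<and> g (g v) = v \<and>
      (\<forall>u\<in>pverts H. (v, u) \<in> parcs H \<longleftrightarrow> u \<noteq> v \<and> u \<noteq> g v)"
    if v: "v \<in> pverts H - universal_verts H" for v
  proof -
    have nu: "g v \<in> pverts H - universal_verts H"
      using g[OF v] v sym[of v "g v"] not_sym[of "g v" v] unfolding universal_verts_def by blast
    moreover have "g (g v) = v"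
      using co_matchingD[OF assms(1), of "g v" "g (g v)" v] g[OF v] g[OF nu] sym v by auto
    moreover have "(v, u) \<in> parcs H \<longleftrightarrow> u \<noteq> v \<and> u \<noteq> g v" if "u \<in> pverts H" for u
      using co_matchingD[OF assms(1), of v u "g v"] g[OF v] that v assms(3) by auto
    ultimately show ?thesis using g[OF v] by blast
  qed
  then show thesis using that by blast
qed

lemma even_card_non_universal:
  assumes "pair_graph H" and "co_matching H"
  shows "even (card (pverts H - universal_verts H))"
proof -
  interpret H: pair_graph H by fact
  have "sym (parcs H)" using H.arcs_symmetric by (auto intro: symI)
  then obtain g where "\<forall>v\<in>pverts H - universal_verts H.
      g v \<in> pverts H - universal_verts H \<and> g v \<noteq> v \<and> g (g v) = v \<and>
      (\<forall>u\<in>pverts H. (v, u) \<in> parcs H \<longleftrightarrow> u \<noteq> v \<and> u \<noteq> g v)"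
    by (rule co_matching_partner[OF assms(2)]) (use H.no_loops' in blast)
  then show ?thesis
    using H.pair_finite_verts by (intro even_card_involution[of _ g]) auto
qed

text \<open>The partner map is a fixed-point-free involution on \<open>W\<close>, and its pairs are
  precisely the non-edges there; they form the deleted one-factor.\<close>

lemma complete_minus_one_factor_non_universal:
  assumes "pair_graph H" and "co_matching H"
  defines "W \<equiv> pverts H - universal_verts H"
  shows "complete_minus_one_factor (card W) \<lparr>pverts = W, parcs = parcs H \<inter> W \<times> W\<rparr>"
proof -
  interpret H: pair_graph H by fact
  have "sym (parcs H)" using H.arcs_symmetric by (auto intro: symI)
  then obtain g where "\<forall>v\<in>pverts H - universal_verts H.
      g v \<in> pverts H - universal_verts H \<and> g v \<noteq> v \<and> g (g v) = v \<and>
      (\<forall>u\<in>pverts H. (v, u) \<in> parcs H \<longleftrightarrow> u \<noteq> v \<and> u \<noteq> g v)"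
    by (rule co_matching_partner[OF assms(2)]) (use H.no_loops' in blast)
  then have g: "\<forall>v\<in>W. g v \<in> W \<and> g v \<noteq> v \<and> g (g v) = v \<and>
      (\<forall>u\<in>pverts H. (v, u) \<in> parcs H \<longleftrightarrow> u \<noteq> v \<and> u \<noteq> g v)"
    by (simp only: W_def)
  have "W \<subseteq> pverts H" "finite W"
    using H.pair_finite_verts by (auto simp: W_def)
  with g show ?thesis
    by (intro complete_minus_one_factorI[where g = g]) auto
qed

text \<open>The involution is conjugated by \<open>f\<close>. This permits relabelling the vertices
  by natural numbers.\<close>

lemma complete_minus_one_factor_image:
  assumes "complete_minus_one_factor n A" and inj: "inj_on f (pverts A)"
  shows "complete_minus_one_factor n
    \<lparr>pverts = f ` pverts A, parcs = map_prod f f ` parcs A\<rparr>"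
proof -
  obtain g where g: "finite (pverts A)" "card (pverts A) = n"
    "\<forall>v\<in>pverts A. g v \<in> pverts A \<and> g v \<noteq> v \<and> g (g v) = v"
    "parcs A = {(u, v). u \<in> pverts A \<and> v \<in> pverts A \<and> u \<noteq> v \<and> v \<noteq> g u}"
    using assms(1) by (rule complete_minus_one_factorE)
  define h where "h = f \<circ> g \<circ> the_inv_into (pverts A) f"
  have h: "h (f v) = f (g v)" if "v \<in> pverts A" for v
    using inj that by (simp add: h_def the_inv_into_f_f)
  have eq: "f u = f v \<longleftrightarrow> u = v" if "u \<in> pverts A" "v \<in> pverts A" for u v
    using inj that by (rule inj_on_eq_iff)
  show ?thesis
  proof (rule complete_minus_one_factorI[where g = h]; simp)
    show "finite (f ` pverts A)" using g(1) by simp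
    show "card (f ` pverts A) = n" using g(2) inj by (simp add: card_image)
    show "h v \<in> f ` pverts A \<and> h v \<noteq> v \<and> h (h v) = v" if "v \<in> f ` pverts A" for v
      using that g(3) h eq by auto
    show "map_prod f f ` parcs A =
        {(u, v). u \<in> f ` pverts A \<and> v \<in> f ` pverts A \<and> u \<noteq> v \<and> v \<noteq> h u}"
    proof (intro equalityI subsetI; clarify)
      fix u v assume "(u, v) \<in> parcs A"
      then show "f u \<in> f ` pverts A \<and> f v \<in> f ` pverts A \<and> f u \<noteq> f v \<and> f v \<noteq> h (f u)"
        using g(3) h eq unfolding g(4) by auto
    next
      fix u v assume "u \<in> pverts A" "v \<in> pverts A" "f u \<noteq> f v" "f v \<noteq> h (f u)"
      then have "(u, v) \<in> parcs A"
        using h unfolding g(4) by auto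
      then show "(f u, f v) \<in> map_prod f f ` parcs A" by force
    qed
  qed
qed

lemma complete_minus_one_factor_iff:
  assumes "pair_graph H" and "co_matching H"
  shows "complete_minus_one_factor (card (pverts H)) H \<longleftrightarrow> universal_verts H = {}"
proof
  assume "complete_minus_one_factor (card (pverts H)) H"
  then obtain g where "\<forall>v\<in>pverts H. g v \<in> pverts H \<and> g v \<noteq> v \<and> g (g v) = v"
    "parcs H = {(u, v). u \<in> pverts H \<and> v \<in> pverts H \<and> u \<noteq> v \<and> v \<noteq> g u}"
    by (rule complete_minus_one_factorE)
  then show "universal_verts H = {}"
    by (auto simp: universal_verts_def)
next
  interpret H: pair_graph H by fact
  assume "universal_verts H = {}"
  \<comment> \<open>All arcs have their ends in \<open>pverts H\<close>, so restricting to the whole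
    vertex set changes nothing.\<close>
  moreover have "\<lparr>pverts = pverts H, parcs = parcs H \<inter> pverts H \<times> pverts H\<rparr> = H"
    using H.in_arcsD1 H.in_arcsD2 by (intro pair_pre_digraph.equality) auto
  ultimately show "complete_minus_one_factor (card (pverts H)) H"
    using complete_minus_one_factor_non_universal[OF assms] by simp
qed

section \<open>Joins with a single vertex\<close>

text \<open>In the join each \<open>Inl a\<close> misses its partner \<open>Inl (g a)\<close>, so
  only the added vertex \<open>Inr p\<close> can be universal; the isomorphism carries this back to
  \<open>H\<close>.\<close>

lemma universal_vert_of_join:
  assumes "pair_graph H" and H1: "complete_minus_one_factor n H\<^sub>1"
    and P: "complete_digraph 1 (with_proj P)"
    and iso: "digraph_iso (with_proj H) (with_proj (graph_join H\<^sub>1 P))"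
    and "x \<in> universal_verts H" "y \<in> universal_verts H"
  shows "x = y"
proof -
  interpret H: pair_graph H by fact
  obtain g where g: "\<forall>v\<in>pverts H\<^sub>1. g v \<in> pverts H\<^sub>1 \<and> g v \<noteq> v \<and> g (g v) = v"
    "parcs H\<^sub>1 = {(u, v). u \<in> pverts H\<^sub>1 \<and> v \<in> pverts H\<^sub>1 \<and> u \<noteq> v \<and> v \<noteq> g u}"
    using H1 by (rule complete_minus_one_factorE)
  obtain p where p: "pverts P = {p}"
    using P by (auto simp: complete_digraph_pair_def card_1_singleton_iff)
  obtain f where f: "bij_betw f (pverts H) (pverts H\<^sub>1 <+> pverts P)"
    "parcs (graph_join H\<^sub>1 P) = map_prod f f ` parcs H"
  proof -
    have "pverts (graph_join H\<^sub>1 P) = pverts H\<^sub>1 <+> pverts P"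
      by (simp add: graph_join_def)
    then show thesis
      using that iso unfolding digraph_iso_with_proj_iff[OF H.pair_wf_digraph] by auto
  qed
  have "f z = Inr p" if z: "z \<in> universal_verts H" for z
  proof (rule ccontr)
    assume "f z \<noteq> Inr p"
    moreover have zV: "z \<in> pverts H"
      using z by (simp add: universal_verts_def)
    ultimately obtain a where a: "f z = Inl a" "a \<in> pverts H\<^sub>1"
      using bij_betwE[OF f(1)] p by fastforce
    then have "Inl (g a) \<in> f ` pverts H"
      using g(1) f(1) by (auto simp: bij_betw_def)
    then obtain w where w: "w \<in> pverts H" "f w = Inl (g a)" by force
    then have "w \<noteq> z" using a g(1) by auto
    then have "(z, w) \<in> parcs H"
      using z w by (simp add: universal_verts_def)
    then have "(Inl a, Inl (g a)) \<in> parcs (graph_join H\<^sub>1 P)"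
      using a w unfolding f(2) by force
    then show False
      using g(2) by (auto simp: graph_join_def)
  qed
  then have "f x = f y" using assms(5,6) by simp
  then show ?thesis
    using f(1) assms(5,6) by (auto simp: bij_betw_def universal_verts_def dest: inj_onD)
qed

text \<open>The universal vertex \<open>x\<close> plays the role of \<open>K_1\<close>, and the
  other vertices, all matched in the complement, form \<open>H\<^sub>1\<close>.\<close>

lemma join_of_universal_vert:
  assumes "pair_graph H" and "co_matching H" and U: "universal_verts H = {x}"
    and n: "card (pverts H) = Suc n"
  shows "\<exists>(H\<^sub>1 :: nat pair_pre_digraph) (P :: nat pair_pre_digraph).
    complete_minus_one_factor n H\<^sub>1 \<and> complete_digraph 1 (with_proj P) \<and>
    digraph_iso (with_proj H) (with_proj (graph_join H\<^sub>1 P))"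
proof -
  interpret H: pair_graph H by fact
  define W where "W = pverts H - {x}"
  have x: "x \<in> pverts H" "\<And>y. y \<in> W \<Longrightarrow> (x, y) \<in> parcs H \<and> (y, x) \<in> parcs H"
    using U H.arcs_symmetric unfolding universal_verts_def W_def by blast+
  have W: "finite W" "card W = n" "pverts H = insert x W" "x \<notin> W"
    using n x H.pair_finite_verts by (auto simp: W_def)
  have arcs: "parcs H = (parcs H \<inter> W \<times> W) \<union> {x} \<times> W \<union> W \<times> {x}"
  proof -
    have "(u, v) \<in> parcs H \<longleftrightarrow> (u, v) \<in> (parcs H \<inter> W \<times> W) \<union> {x} \<times> W \<union> W \<times> {x}" for u v
      using x(2)[of u] x(2)[of v] H.in_arcsD1[of u v] H.in_arcsD2[of u v] H.no_loops'[of u v]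
      by (auto simp: W_def)
    then show ?thesis by auto
  qed
  \<comment> \<open>Numbering \<open>W\<close> moves the first factor to vertices of type
    \<open>nat\<close>.\<close>
  obtain h where h: "bij_betw h W {0..<card W}"
    using ex_bij_betw_finite_nat[OF W(1)] by blast
  let ?A = "\<lparr>pverts = h ` W, parcs = map_prod h h ` (parcs H \<inter> W \<times> W)\<rparr>"
  let ?P = "\<lparr>pverts = {0 :: nat}, parcs = {}\<rparr>"
  have "complete_minus_one_factor n ?A"
    using complete_minus_one_factor_image[OF complete_minus_one_factor_non_universal[OF assms(1,2)],
      of h] h W by (simp add: U W_def[symmetric] bij_betw_def)
  moreover have "complete_digraph 1 (with_proj ?P)"
    by (auto simp: complete_digraph_pair_def)
  moreover have "digraph_iso (with_proj H) (with_proj (graph_join ?A ?P))"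
  proof -
    define f :: "'a \<Rightarrow> nat + nat" where "f v = (if v = x then Inr 0 else Inl (h v))" for v
    have fx: "f x = Inr 0" and fW: "\<And>v. v \<in> W \<Longrightarrow> f v = Inl (h v)"
      using W(4) by (auto simp: f_def)
    have img: "f ` W = Inl ` h ` W" "map_prod f f ` (parcs H \<inter> W \<times> W) =
        map_prod Inl Inl ` map_prod h h ` (parcs H \<inter> W \<times> W)"
      unfolding image_image using fW by (auto intro!: image_cong)
    have "inj_on f (pverts H)"
      using h fx fW W(4) unfolding W(3) by (auto simp: inj_on_def bij_betw_def)
    moreover have "f ` pverts H = pverts (graph_join ?A ?P)"
      unfolding W(3) using fx img by (auto simp: graph_join_def Plus_def)
    moreover have "map_prod f f ` parcs H = parcs (graph_join ?A ?P)"
    proof -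
      have "map_prod f f ` ({x} \<times> W) = {f x} \<times> f ` W" "map_prod f f ` (W \<times> {x}) = f ` W \<times> {f x}"
        by force+
      then show ?thesis
        by (subst arcs) (auto simp: graph_join_def image_Un fx img)
    qed
    ultimately show ?thesis
      unfolding digraph_iso_with_proj_iff[OF H.pair_wf_digraph] bij_betw_def by metis
  qed
  ultimately show ?thesis by blast
qed

section \<open>The characterisation by the parity of the colour number\<close>

theorem theorem16:
  fixes m k :: nat
    and G :: "'b pair_pre_digraph"
    and H K :: "'a pair_pre_digraph"
  assumes "even m" and "m \<ge> 2" and "k \<ge> 1"
    and "m = 2 \<Longrightarrow> k \<le> 2"
    and "complete_minus_one_factor m G"
    and "complete_digraph ((k - 1) * (m - 1) + 1) (with_proj K)"
    and "pair_graph H" and "subgraph (with_proj H) (with_proj K)"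
    and "connected (with_proj H)"
    and "free_chromatic_number G H = k"
  shows "k_free_minimal k G H \<longleftrightarrow>
    (even k \<and> complete_minus_one_factor ((k - 1) * (m - 1) + 1) H) \<or>
    (odd k \<and> (\<exists>(H\<^sub>1 :: nat pair_pre_digraph) (P :: nat pair_pre_digraph).
       complete_minus_one_factor ((k - 1) * (m - 1)) H\<^sub>1 \<and>
       complete_digraph 1 (with_proj P) \<and>
       digraph_iso (with_proj H) (with_proj (graph_join H\<^sub>1 P))))"
proof -
  interpret cocktail_party_graph m G
    using assms(2,5) by unfold_locales
  let ?n = "(k - 1) * (m - 1)"
  have not_colourable: "\<not> free_colouring G (k - 1) H \<pi>" for \<pi>
    using free_chromatic_number_le[of "k - 1" H \<pi>] assms(3,10) by fastforce
  have "pverts H \<subseteq> pverts K" "finite (pverts K)" "card (pverts K) = ?n + 1"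
    using assms(6) subgraph_imp_subverts[OF assms(8)] by (simp_all add: complete_digraph_pair_def)
  then have "card (pverts H) \<le> ?n + 1"
    using card_mono by metis
  \<comment> \<open>With at most \<open>?n\<close> vertices, \<open>k - 1\<close> classes of size
    \<open>m - 1\<close> would suffice; hence \<open>H\<close> spans \<open>K\<close>.\<close>
  moreover have "\<not> card (pverts H) \<le> ?n"
    using colourable_of_small[OF assms(7)] not_colourable by blast
  ultimately have card_H: "card (pverts H) = ?n + 1" by simp
  have co: "co_matching H"
    using colourable_of_not_co_matching[OF assms(7), of "k - 1"] card_H not_colourable assms(4)
    by fastforce
  have minimal: "k_free_minimal k G H \<longleftrightarrow> (\<forall>x\<in>universal_verts H. \<forall>y\<in>universal_verts H. x = y)"
    unfolding k_free_minimal_def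
    using free_minimal_iff[OF assms(7) co card_H assms(10,4)] assms(10) by simp
  \<comment> \<open>As \<open>m - 1\<close> is odd and \<open>k \<ge> 1\<close>, the number
    \<open>?n\<close> has the parity of \<open>k - 1\<close>.\<close>
  have parity: "even (card (pverts H)) \<longleftrightarrow> even k"
    using assms(1-3) unfolding card_H by auto
  have even_rest: "even (card (pverts H - universal_verts H))"
    using even_card_non_universal[OF assms(7) co] .
  have sub: "universal_verts H \<subseteq> pverts H" by (auto simp: universal_verts_def)
  have at_most_one: "(\<forall>x\<in>universal_verts H. \<forall>y\<in>universal_verts H. x = y) \<longleftrightarrow>
      universal_verts H = {} \<or> (\<exists>x. universal_verts H = {x})"
  proof
    assume "\<forall>x\<in>universal_verts H. \<forall>y\<in>universal_verts H. x = y"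
    then show "universal_verts H = {} \<or> (\<exists>x. universal_verts H = {x})"
      using is_singletonI'[of "universal_verts H"] unfolding is_singleton_def by blast
  qed auto
  show ?thesis
  proof (cases "even k")
    case True
    \<comment> \<open>A single universal vertex would leave an odd number of vertices, yet these are
      paired off by the matching.\<close>
    have "universal_verts H \<noteq> {x}" for x
      using even_rest sub True parity card_H by (auto simp: card_Diff_subset)
    then show ?thesis
      using complete_minus_one_factor_iff[OF assms(7) co] minimal at_most_one True card_H
      by auto
  next
    case False
    \<comment> \<open>An odd number of vertices cannot all be paired, so minimality now means
      exactly one universal vertex.\<close>
    have "universal_verts H \<noteq> {}"
      using even_rest parity False by auto
    then show ?thesis
      using minimal at_most_one False join_of_universal_vert[OF assms(7) co] card_H
        universal_vert_of_join[OF assms(7)] by (metis Suc_eq_plus1)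
  qed
qed

end
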